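(* Assume that $\{\kappa_\tau,\tau>0\}$ satisfies: for each $\tau>0$, $\kappa_\tau$ is supported on a compact set $K_0\subset\mathbb{R}^p$ independent of $\tau$. Assume also that $\ell(\theta)=\log f_Y(y^*;\theta)$ is twice differentiable and that for any compact set $K_1\subset\mathbb{R}^p$, $\sup_{\theta\in K_1}|\nabla\ell(\theta)|<\infty$ and $\sup_{\theta\in K_1}|\nabla^2\ell(\theta)|<\infty$. Let $h:\mathbb{R}^p\to\mathbb{R}^m$ be a measurable function possessing constants $\alpha\ge 0$, $c>0$ and $\varepsilon>0$ such that, whenever $u\in B(\varepsilon)$, $|h(u)|\le c|u|^\alpha$. Define $\tau_0=\sup\{\tau : K_0\subset B(\varepsilon/\tau)\}$. Then for any compact set $K_2\subset\mathbb{R}^p$ there exist $C_1<\infty$ and a positive constant $\tau_1\le\tau_0$ such that, for all $0<\tau\le\tau_1$, $$\sup_{\theta\in K_2}\left|\breve{\mathbb{E}}_{\theta,\tau}\big[h(\breve\Theta-\theta)\mid \breve Y=y^*\big]-\int h(\tau u)\kappa_\tau(u)\,du-\tau\left\{\int h(\tau u)u'\kappa_\tau(u)\,du\right\}\nabla\ell(\theta)\right|\le C_1\tau^{2+\alpha}.$$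
   Context: Latent variable model: $f_{XY}(x,y;\theta)$ is the joint density of a pair of random variables $(X,Y)$ with values in a measurable space $\mathfrak{X}\times\mathfrak{Y}$, depending on a parameter $\theta\in\mathbb{R}^p$, with respect to a $\sigma$-finite product measure denoted $dx\,dy$. $f_Y(y;\theta)=\int f_{XY}(x,y;\theta)\,dx$ is the marginal density of $Y$. The data are a fixed value $y^*\in\mathfrak{Y}$, and $\ell(\theta)=\log f_Y(y^*;\theta)$ is the log likelihood function. Stochastically perturbed model: $\{\kappa_\tau,\tau>0\}$ is a collection of mean-zero probability densities on $\mathbb{R}^p$ with respect to Lebesgue measure. For $\theta\in\mathbb{R}^p$ and $\tau>0$, the triplet $(\breve X,\breve Y,\breve\Theta)$ has joint density on $\mathfrak{X}\times\mathfrak{Y}\times\mathbb{R}^p$ $$g_{\breve X,\breve Y,\breve\Theta}(x,y,\breve\vartheta;\theta,\tau)=f_{XY}(x,y;\breve\vartheta)\,\tau^{-p}\kappa_\tau\big((\breve\vartheta-\theta)/\tau\big).$$ $\breve{\mathbb{E}}_{\theta,\tau}$ denotes expectation with respect to this model; conditional expectation given $\breve Y=y^*$ is the one computed from the conditional density given by this joint density. Notation: vectors are column vectors and $u'$ is the transpose of $u$; integrals of vector- or matrix-valued functions are taken componentwise; $\nabla$ is the column-vector gradient and $\nabla^2$ the matrix of second derivatives; $|\cdot|$ is the absolute value (norm) of a vector or the largest absolute eigenvalue of a square matrix; $B(r)=\{u\in\mathbb{R}^p:|u|\le r\}$. *)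

theory Defs
  imports "HOL-Probability.Probability"
begin

definition prob_density :: "'a measure \<Rightarrow> ('a \<Rightarrow> real) \<Rightarrow> bool" where
  "prob_density M p \<longleftrightarrow>
     p \<in> borel_measurable M \<and> (\<forall>z\<in>space M. 0 \<le> p z) \<and> (\<integral>\<^sup>+z. ennreal (p z) \<partial>M) = 1"

definition marginal_density :: "'x measure \<Rightarrow> ('x \<Rightarrow> 'y \<Rightarrow> 'p \<Rightarrow> real) \<Rightarrow> 'y \<Rightarrow> 'p \<Rightarrow> real" where
  "marginal_density MX f y \<theta> = (\<integral>x. f x y \<theta> \<partial>MX)"

definition log_likelihood :: "'x measure \<Rightarrow> ('x \<Rightarrow> 'y \<Rightarrow> 'p \<Rightarrow> real) \<Rightarrow> 'y \<Rightarrow> 'p \<Rightarrow> real" where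
  "log_likelihood MX f y \<theta> = ln (marginal_density MX f y \<theta>)"

definition perturbed_density ::
  "('x \<Rightarrow> 'y \<Rightarrow> real^'p \<Rightarrow> real) \<Rightarrow> (real \<Rightarrow> real^'p \<Rightarrow> real) \<Rightarrow> real^'p \<Rightarrow> real
    \<Rightarrow> 'x \<times> 'y \<times> (real^'p) \<Rightarrow> real" where
  "perturbed_density f \<kappa> \<theta> \<tau> =
     (\<lambda>(x, y, \<phi>). f x y \<phi> * (inverse (\<tau> ^ CARD('p)) * \<kappa> \<tau> ((\<phi> - \<theta>) /\<^sub>R \<tau>)))"

text \<open>Expectation of \<open>Z (X, Y, \<Theta>)\<close> given \<open>Y = y\<close>, where \<open>(X, Y, \<Theta>)\<close> has joint density \<open>g\<close>:
  the integral of \<open>Z\<close> against the conditional density of \<open>(X, \<Theta>)\<close> given \<open>Y = y\<close>, that is,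
  \<open>g\<close> divided by the marginal density of \<open>Y\<close> at the point \<open>y\<close>.\<close>

definition cond_expectation ::
  "'x measure \<Rightarrow> ('x \<times> 'y \<times> (real^'p) \<Rightarrow> real) \<Rightarrow> ('x \<times> 'y \<times> (real^'p) \<Rightarrow> real^'m) \<Rightarrow> 'y \<Rightarrow> real^'m"
  where
  "cond_expectation MX g Z y =
     (\<integral>(x, \<phi>). (g (x, y, \<phi>) / (\<integral>(x', \<phi>'). g (x', y, \<phi>') \<partial>(MX \<Otimes>\<^sub>M lborel))) *\<^sub>R Z (x, y, \<phi>)
        \<partial>(MX \<Otimes>\<^sub>M lborel))"

definition gradient :: "(real^'p \<Rightarrow> real) \<Rightarrow> real^'p \<Rightarrow> real^'p" where
  "gradient f x = (THE D. GDERIV f x :> D)"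

definition hessian :: "(real^'p \<Rightarrow> real) \<Rightarrow> real^'p \<Rightarrow> real^'p^'p" where
  "hessian f x = jacobian (gradient f) (at x)"

definition twice_differentiable :: "(real^'p \<Rightarrow> real) \<Rightarrow> bool" where
  "twice_differentiable f \<longleftrightarrow>
     (\<forall>x. f differentiable (at x)) \<and> (\<forall>x. gradient f differentiable (at x))"

text \<open>Eigenvalues of a real matrix are taken over the complex numbers; the set of their absolute
  values is finite and nonempty, so its supremum is the largest one.\<close>

definition max_abs_eigenvalue :: "real^'n^'n \<Rightarrow> real" where
  "max_abs_eigenvalue A =
     Sup {cmod z | z. \<exists>v::complex^'n. v \<noteq> 0 \<and>
                        (\<chi> i j. complex_of_real (A $ i $ j)) *v v = z *s v}"

definition outer :: "real^'m \<Rightarrow> real^'p \<Rightarrow> real^'p^'m" where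
  "outer a b = (\<chi> i j. a $ i * b $ j)"

text \<open>The real power with the convention that \<open>0\<close> to the power \<open>0\<close> is \<open>1\<close>;
  note that \<open>0 powr 0 = 0\<close>.\<close>

definition rpow :: "real \<Rightarrow> real \<Rightarrow> real" where
  "rpow x a = (if a = 0 then 1 else x powr a)"

end

theory Submission
  imports Defs
begin

text \<open>
  Write \<open>m\<close> for the marginal density of the observation, so that \<open>l = ln m\<close>.  Integrating out the
  latent variable and substituting \<open>\<phi> = \<theta> + \<tau> u\<close> turns the conditional expectation into the ratio
  \<open>E[L H] / E[L]\<close> (\<open>cond_expectation_perturbed\<close>), where \<open>E\<close> is expectation over \<open>u\<close> with density
  \<open>\<kappa> \<tau>\<close>, \<open>H u = h (\<tau> u)\<close>, and \<open>L u = m (\<theta> + \<tau> u) / m \<theta> = exp (l (\<theta> + \<tau> u) - l \<theta>)\<close>.  With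
  \<open>Z u = \<tau> (u \<bullet> gradient l \<theta>)\<close>, the bounds on the gradient and the Hessian give \<open>L = 1 + Z + O(\<tau>\<^sup>2)\<close>
  uniformly for \<open>\<theta> \<in> K2\<close> and \<open>u \<in> K0\<close>, while \<open>H = O(\<tau> powr \<alpha>)\<close>.  Hence
  \<open>E[L H] = E[H] + E[Z H] + O(\<tau> powr (2 + \<alpha>))\<close>.  Because \<open>E[Z] = 0\<close>, the normalisation satisfies
  \<open>E[L] = 1 + O(\<tau>\<^sup>2)\<close>, so dividing by it costs another \<open>O(\<tau> powr (2 + \<alpha>))\<close>.  This is
  \<open>reweighted_expectation_approx\<close>.

  The Hessian is controlled only through its eigenvalues, whereas Taylor's formula needs its quadratic
  form.  The two are comparable because the Hessian is symmetric.  As the second derivative is not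
  assumed to be continuous, symmetry is obtained from differentiability of the gradient at the
  single point in question (\<open>second_derivative_symmetric\<close>).  For a symmetric matrix the extreme values of the quadratic
  form on the unit sphere are eigenvalues (\<open>symmetric_abs_quadratic_form_le\<close>), and applying the mean
  value theorem twice along a segment then gives \<open>first_order_taylor_bounds\<close>.
\<close>

section \<open>Gradients, Hessians and symmetry of the second derivative\<close>

lemma gradient_GDERIV:
  fixes f :: "real^'p \<Rightarrow> real"
  assumes "f differentiable (at x)"
  shows "GDERIV f x :> gradient f x"
proof -
  obtain f' where f': "(f has_derivative f') (at x)"
    using assms by (auto simp: differentiable_def)
  have lin: "linear f'"
    using f' by (rule has_derivative_linear)
  have "f' = (\<lambda>h. h \<bullet> adjoint f' 1)"
    using adjoint_works[OF lin, of _ 1] by (auto simp: inner_commute)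
  with f' have D: "GDERIV f x :> adjoint f' 1"
    by (simp add: gderiv_def)
  have "E = adjoint f' 1" if "GDERIV f x :> E" for E
  proof -
    have "(\<lambda>h. h \<bullet> E) = (\<lambda>h. h \<bullet> adjoint f' 1)"
      using that D unfolding gderiv_def by (rule has_derivative_unique)
    then have "(E - adjoint f' 1) \<bullet> (E - adjoint f' 1) = 0"
      by (metis inner_diff_right right_minus_eq)
    then show ?thesis by simp
  qed
  with D show ?thesis
    unfolding gradient_def by (metis theI)
qed

lemma hessian_has_derivative:
  fixes f :: "real^'p \<Rightarrow> real"
  assumes "gradient f differentiable (at x)"
  shows "(gradient f has_derivative (*v) (hessian f x)) (at x)"
  using assms unfolding hessian_def by (simp add: jacobian_works)

lemma GDERIV_along_line:
  fixes f :: "'a::real_inner \<Rightarrow> real"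
  assumes "GDERIV f (a + s *\<^sub>R v) :> D"
  shows "((\<lambda>s. f (a + s *\<^sub>R v)) has_real_derivative v \<bullet> D) (at s)"
proof -
  have "((\<lambda>s. a + s *\<^sub>R v) has_derivative (\<lambda>t. t *\<^sub>R v)) (at s)"
    by (auto intro!: derivative_eq_intros)
  from has_derivative_compose[OF this assms[unfolded gderiv_def]]
  show ?thesis
    by (simp add: has_field_derivative_def mult.commute[of _ "v \<bullet> D"] mult_commute_abs)
qed

text \<open>
  The second difference of \<open>f\<close> over a small parallelogram is \<open>t\<^sup>2 (v \<bullet> H u)\<close> up to \<open>o(t\<^sup>2)\<close>.  The mean
  value theorem is applied to the difference of \<open>f\<close> along the two sides parallel to \<open>v\<close>, and the
  derivative of \<open>G\<close> is used only at \<open>x\<close>.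
\<close>

lemma second_difference_approx:
  fixes f :: "'a::real_inner \<Rightarrow> real"
  assumes G: "\<And>y. GDERIV f y :> G y"
    and H: "(G has_derivative H) (at x)" and "0 < e"
  shows "\<exists>d>0. \<forall>t. 0 < t \<and> t < d \<longrightarrow>
    \<bar>f (x + t *\<^sub>R u + t *\<^sub>R v) - f (x + t *\<^sub>R u) - f (x + t *\<^sub>R v) + f x - t\<^sup>2 * (v \<bullet> H u)\<bar>
      \<le> e * t\<^sup>2"
proof -
  define K where "K = norm u + norm v + 1"
  have K: "0 < K" "norm v \<le> K" "norm u + norm v \<le> K"
    unfolding K_def by (auto intro: add_nonneg_pos)
  define e' where "e' = e / (2 * K * K)"
  have e': "0 < e'" using K \<open>0 < e\<close> by (simp add: e'_def)
  interpret H: bounded_linear H using H by (rule has_derivative_bounded_linear)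
  from H e' obtain d where d: "0 < d"
    and le: "\<And>y. norm (y - x) < d \<Longrightarrow> norm (G y - G x - H (y - x)) \<le> e' * norm (y - x)"
    unfolding has_derivative_at_alt by blast
  show ?thesis
  proof (intro exI[of _ "d / K"] conjI allI impI)
    show "0 < d / K" using d K by simp
    fix t assume t: "0 < t \<and> t < d / K"
    have tK: "t * K < d" using t K by (simp add: field_simps)
    \<comment> \<open>\<open>\<phi> 1 - \<phi> 0\<close> is the second difference.\<close>
    define \<phi> where "\<phi> s = f ((x + t *\<^sub>R u) + s *\<^sub>R (t *\<^sub>R v)) - f (x + s *\<^sub>R (t *\<^sub>R v))" for s
    define \<phi>' where "\<phi>' s = (t *\<^sub>R v) \<bullet> G ((x + t *\<^sub>R u) + s *\<^sub>R (t *\<^sub>R v))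
      - (t *\<^sub>R v) \<bullet> G (x + s *\<^sub>R (t *\<^sub>R v))" for s
    have "DERIV \<phi> s :> \<phi>' s" for s
      unfolding \<phi>_def \<phi>'_def by (intro DERIV_diff GDERIV_along_line G)
    from MVT2[of 0 1 \<phi> \<phi>', OF _ this] obtain s where s: "0 < s" "s < 1"
      and eq: "\<phi> 1 - \<phi> 0 = \<phi>' s" by auto
    have rem: "norm (G (x + w) - G x - H w) \<le> e' * (t * K)" if "norm w \<le> t * K" for w
    proof -
      have "norm (G (x + w) - G x - H w) \<le> e' * norm w"
        using le[of "x + w"] that tK by simp
      also have "\<dots> \<le> e' * (t * K)" using that e' by (intro mult_left_mono) auto
      finally show ?thesis .
    qed
    have sv: "norm (s *\<^sub>R t *\<^sub>R v) \<le> t * norm v"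
      using s t by (simp add: mult_left_le_one_le)
    have w2: "norm (s *\<^sub>R t *\<^sub>R v) \<le> t * K"
      using sv K(2) t by (meson mult_left_mono order.strict_implies_order order.trans)
    have "norm (t *\<^sub>R u + s *\<^sub>R t *\<^sub>R v) \<le> t * norm u + t * norm v"
      using norm_triangle_ineq[of "t *\<^sub>R u" "s *\<^sub>R t *\<^sub>R v"] sv t by simp
    also have "\<dots> \<le> t * K"
      using K(3) t by (simp flip: distrib_left)
    finally have w1: "norm (t *\<^sub>R u + s *\<^sub>R t *\<^sub>R v) \<le> t * K" .
    define r1 where "r1 = G (x + (t *\<^sub>R u + s *\<^sub>R t *\<^sub>R v)) - G x - H (t *\<^sub>R u + s *\<^sub>R t *\<^sub>R v)"
    define r2 where "r2 = G (x + s *\<^sub>R t *\<^sub>R v) - G x - H (s *\<^sub>R t *\<^sub>R v)"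
    have r: "norm (r1 - r2) \<le> 2 * (e' * (t * K))"
      using norm_triangle_ineq4[of r1 r2] rem[OF w1] rem[OF w2] unfolding r1_def r2_def by linarith
    have "\<phi>' s - t\<^sup>2 * (v \<bullet> H u) = t * (v \<bullet> (r1 - r2))"
      by (simp add: \<phi>'_def r1_def r2_def H.add H.scaleR inner_diff_right inner_add_right
          algebra_simps power2_eq_square)
    also have "\<bar>\<dots>\<bar> \<le> t * (norm v * norm (r1 - r2))"
      using t Cauchy_Schwarz_ineq2[of v "r1 - r2"] by (simp add: abs_mult)
    also have "\<dots> \<le> t * (K * (2 * (e' * (t * K))))"
      using t K r by (intro mult_left_mono mult_mono) auto
    also have "\<dots> = e * t\<^sup>2"
      using K by (simp add: e'_def power2_eq_square)
    finally have "\<bar>\<phi> 1 - \<phi> 0 - t\<^sup>2 * (v \<bullet> H u)\<bar> \<le> e * t\<^sup>2"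
      using eq by simp
    then show "\<bar>f (x + t *\<^sub>R u + t *\<^sub>R v) - f (x + t *\<^sub>R u) - f (x + t *\<^sub>R v) + f x - t\<^sup>2 * (v \<bullet> H u)\<bar>
      \<le> e * t\<^sup>2"
      by (simp add: \<phi>_def algebra_simps)
  qed
qed

text \<open>The second difference is symmetric in \<open>u\<close> and \<open>v\<close>, hence so is its leading coefficient.\<close>

lemma second_derivative_symmetric:
  fixes f :: "'a::real_inner \<Rightarrow> real"
  assumes G: "\<And>y. GDERIV f y :> G y" and H: "(G has_derivative H) (at x)"
  shows "v \<bullet> H u = u \<bullet> H v"
proof -
  have "\<bar>v \<bullet> H u - u \<bullet> H v\<bar> \<le> e" if "0 < e" for e
  proof -
    from that have e2: "0 < e / 2" by simp
    from second_difference_approx[OF G H e2, of u v] obtain d1 where d1: "d1 > 0"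
      "\<And>t. 0 < t \<Longrightarrow> t < d1 \<Longrightarrow> \<bar>f (x + t *\<^sub>R u + t *\<^sub>R v) - f (x + t *\<^sub>R u) - f (x + t *\<^sub>R v) + f x
         - t\<^sup>2 * (v \<bullet> H u)\<bar> \<le> e / 2 * t\<^sup>2" by blast
    from second_difference_approx[OF G H e2, of v u] obtain d2 where d2: "d2 > 0"
      "\<And>t. 0 < t \<Longrightarrow> t < d2 \<Longrightarrow> \<bar>f (x + t *\<^sub>R v + t *\<^sub>R u) - f (x + t *\<^sub>R v) - f (x + t *\<^sub>R u) + f x
         - t\<^sup>2 * (u \<bullet> H v)\<bar> \<le> e / 2 * t\<^sup>2" by blast
    define t where "t = min d1 d2 / 2"
    have t: "0 < t" "t < d1" "t < d2" using d1(1) d2(1) by (auto simp: t_def)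
    have sw: "x + t *\<^sub>R v + t *\<^sub>R u = x + t *\<^sub>R u + t *\<^sub>R v" by (simp add: ac_simps)
    have "\<bar>t\<^sup>2 * (v \<bullet> H u) - t\<^sup>2 * (u \<bullet> H v)\<bar> \<le> e * t\<^sup>2"
      using d1(2)[OF t(1,2)] d2(2)[OF t(1,3)] unfolding sw by linarith
    moreover have "t\<^sup>2 * (v \<bullet> H u) - t\<^sup>2 * (u \<bullet> H v) = t\<^sup>2 * (v \<bullet> H u - u \<bullet> H v)"
      by (simp add: algebra_simps)
    ultimately have "t\<^sup>2 * \<bar>v \<bullet> H u - u \<bullet> H v\<bar> \<le> t\<^sup>2 * e"
      by (simp add: abs_mult mult.commute)
    then show ?thesis using t by simp
  qed
  then have "\<bar>v \<bullet> H u - u \<bullet> H v\<bar> \<le> 0"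
    by (rule field_le_epsilon) auto
  then show ?thesis by simp
qed

section \<open>Quadratic forms of symmetric matrices\<close>

text \<open>Boundedness makes the supremum defining \<^const>\<open>max_abs_eigenvalue\<close> an upper bound.\<close>

lemma bdd_above_cmod_eigenvalues:
  fixes A :: "real^'n^'n"
  shows "bdd_above {cmod z | z. \<exists>v::complex^'n. v \<noteq> 0 \<and>
           (\<chi> i j. complex_of_real (A $ i $ j)) *v v = z *s v}"
proof (rule bdd_aboveI)
  fix r assume "r \<in> {cmod z | z. \<exists>v::complex^'n. v \<noteq> 0 \<and>
           (\<chi> i j. complex_of_real (A $ i $ j)) *v v = z *s v}"
  then obtain z and v :: "complex^'n" where r: "r = cmod z" and v: "v \<noteq> 0"
    and eig: "(\<chi> i j. complex_of_real (A $ i $ j)) *v v = z *s v" by auto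
  define V where "V = (\<Sum>j\<in>UNIV. cmod (v $ j))"
  obtain k where "v $ k \<noteq> 0" using v by (auto simp: vec_eq_iff)
  moreover have le_V: "cmod (v $ j) \<le> V" for j
    unfolding V_def by (rule member_le_sum) auto
  ultimately have V: "0 < V"
    by (meson less_le_trans zero_less_norm_iff)
  \<comment> \<open>Summing these row estimates over \<open>i\<close> and cancelling \<open>V\<close> bounds \<open>cmod z\<close>.\<close>
  have row: "cmod z * cmod (v $ i) \<le> (\<Sum>j\<in>UNIV. \<bar>A $ i $ j\<bar>) * V" for i
  proof -
    have "z * v $ i = (\<Sum>j\<in>UNIV. complex_of_real (A $ i $ j) * v $ j)"
      using arg_cong[OF eig, of "\<lambda>w. w $ i"] by (simp add: matrix_vector_mult_def)
    then have "cmod z * cmod (v $ i) = cmod (\<Sum>j\<in>UNIV. complex_of_real (A $ i $ j) * v $ j)"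
      by (metis norm_mult)
    also have "\<dots> \<le> (\<Sum>j\<in>UNIV. \<bar>A $ i $ j\<bar> * cmod (v $ j))"
      by (rule order.trans[OF norm_sum]) (simp add: norm_mult)
    also have "\<dots> \<le> (\<Sum>j\<in>UNIV. \<bar>A $ i $ j\<bar> * V)"
      by (intro sum_mono mult_left_mono le_V) auto
    finally show ?thesis by (simp add: sum_distrib_right)
  qed
  have "cmod z * V = (\<Sum>i\<in>UNIV. cmod z * cmod (v $ i))"
    by (simp add: V_def sum_distrib_left)
  also have "\<dots> \<le> (\<Sum>i\<in>UNIV. (\<Sum>j\<in>UNIV. \<bar>A $ i $ j\<bar>) * V)"
    by (intro sum_mono row)
  finally have "cmod z * V \<le> (\<Sum>i\<in>UNIV. \<Sum>j\<in>UNIV. \<bar>A $ i $ j\<bar>) * V"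
    by (simp add: sum_distrib_right)
  then show "r \<le> (\<Sum>i\<in>UNIV. \<Sum>j\<in>UNIV. \<bar>A $ i $ j\<bar>)"
    using V r by simp
qed

lemma real_eigenvalue_le_max_abs_eigenvalue:
  fixes A :: "real^'n^'n"
  assumes "A *v v = c *\<^sub>R v" and "v \<noteq> 0"
  shows "\<bar>c\<bar> \<le> max_abs_eigenvalue A"
proof -
  define w :: "complex^'n" where "w = (\<chi> i. complex_of_real (v $ i))"
  have "w \<noteq> 0" using \<open>v \<noteq> 0\<close> by (auto simp: w_def vec_eq_iff)
  moreover have "(\<chi> i j. complex_of_real (A $ i $ j)) *v w = complex_of_real c *s w"
  proof (rule vec_eq_iff[THEN iffD2], rule allI)
    fix i
    have "(\<Sum>j\<in>UNIV. A $ i $ j * v $ j) = c * v $ i"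
      using arg_cong[OF assms(1), of "\<lambda>w. w $ i"] by (simp add: matrix_vector_mult_def)
    from arg_cong[OF this, of complex_of_real]
    show "((\<chi> i j. complex_of_real (A $ i $ j)) *v w) $ i = (complex_of_real c *s w) $ i"
      by (simp add: matrix_vector_mult_def w_def)
  qed
  ultimately show ?thesis
    unfolding max_abs_eigenvalue_def
    by (intro cSup_upper bdd_above_cmod_eigenvalues) (force intro!: exI[of _ "complex_of_real c"])
qed

text \<open>
  First-order condition at a maximizer \<open>v\<close> of the Rayleigh quotient, perturbed in the direction of the
  residual \<open>z = A v - c v\<close>.
\<close>

lemma symmetric_maximizer_eigenvector:
  fixes A :: "real^'n^'n"
  assumes sym: "\<And>u w. u \<bullet> (A *v w) = w \<bullet> (A *v u)"
    and max: "\<And>w. w \<bullet> (A *v w) \<le> c * (w \<bullet> w)" and eq: "v \<bullet> (A *v v) = c * (v \<bullet> v)"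
  shows "A *v v = c *\<^sub>R v"
proof -
  define z where "z = A *v v - c *\<^sub>R v"
  define q where "q = c * (z \<bullet> z) - z \<bullet> (A *v z)"
  have key: "2 * t * (z \<bullet> z) \<le> t\<^sup>2 * q" for t
  proof -
    have "(v + t *\<^sub>R z) \<bullet> (A *v (v + t *\<^sub>R z)) =
        v \<bullet> (A *v v) + 2 * t * (z \<bullet> (A *v v)) + t\<^sup>2 * (z \<bullet> (A *v z))"
      by (simp add: matrix_vector_right_distrib matrix_vector_mult_scaleR inner_add_left
          inner_add_right sym[of v z] power2_eq_square algebra_simps)
    moreover have "c * ((v + t *\<^sub>R z) \<bullet> (v + t *\<^sub>R z)) =
        c * (v \<bullet> v) + 2 * t * (z \<bullet> (c *\<^sub>R v)) + t\<^sup>2 * (c * (z \<bullet> z))"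
      by (simp add: inner_add_left inner_add_right inner_commute[of v z] power2_eq_square algebra_simps)
    ultimately have "2 * t * (z \<bullet> (A *v v)) - 2 * t * (z \<bullet> (c *\<^sub>R v)) \<le> t\<^sup>2 * q"
      using max[of "v + t *\<^sub>R z"] eq by (simp add: q_def right_diff_distrib)
    moreover have "z \<bullet> z = z \<bullet> (A *v v) - z \<bullet> (c *\<^sub>R v)"
      by (simp add: z_def inner_diff_right)
    ultimately show ?thesis by (simp add: right_diff_distrib)
  qed
  have "z \<bullet> z \<le> 0"
  proof (rule ccontr)
    assume "\<not> z \<bullet> z \<le> 0"
    then have pos: "0 < z \<bullet> z" by (simp only: not_le)
    \<comment> \<open>For small \<open>t\<close> the linear term in \<open>key\<close> exceeds the quadratic one.\<close>
    define t where "t = (z \<bullet> z) / (\<bar>q\<bar> + 1)"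
    have t: "0 < t" using pos by (simp add: t_def)
    from key[of t] have "t * (2 * (z \<bullet> z)) \<le> t * (t * q)"
      by (simp add: power2_eq_square ac_simps)
    then have "2 * (z \<bullet> z) \<le> t * q"
      using t by simp
    also have "\<dots> \<le> t * (\<bar>q\<bar> + 1)" using t by (intro mult_left_mono) auto
    also have "\<dots> = z \<bullet> z" by (simp add: t_def)
    finally show False using pos by simp
  qed
  then have "z = 0" by (metis inner_ge_zero antisym inner_eq_zero_iff)
  then show ?thesis by (simp add: z_def)
qed

text \<open>A symmetric matrix attains the maximum of its Rayleigh quotient at a real eigenvector.\<close>

lemma symmetric_quadratic_form_maximum:
  fixes A :: "real^'n^'n"
  assumes sym: "\<And>u w. u \<bullet> (A *v w) = w \<bullet> (A *v u)"
  obtains c v where "A *v v = c *\<^sub>R v" "v \<noteq> 0" "\<And>w. w \<bullet> (A *v w) \<le> c * (w \<bullet> w)"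
proof -
  have "continuous_on (sphere 0 1) (\<lambda>w. w \<bullet> (A *v w))"
    by (intro continuous_intros linear_continuous_on) simp
  moreover have "sphere (0::real^'n) 1 \<noteq> {}" by simp
  ultimately obtain v where v: "norm v = 1"
    and mx: "\<And>w. norm w = 1 \<Longrightarrow> w \<bullet> (A *v w) \<le> v \<bullet> (A *v v)"
    using continuous_attains_sup[of "sphere (0::real^'n) 1"] by fastforce
  define c where "c = v \<bullet> (A *v v)"
  have max: "w \<bullet> (A *v w) \<le> c * (w \<bullet> w)" for w
  proof (cases "w = 0")
    case False
    define e where "e = w /\<^sub>R norm w"
    have w: "w = norm w *\<^sub>R e" and "norm e = 1" using False by (auto simp: e_def)
    have "w \<bullet> (A *v w) = (norm w)\<^sup>2 * (e \<bullet> (A *v e))"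
      by (subst (1 2) w) (simp add: matrix_vector_mult_scaleR power2_eq_square)
    also have "\<dots> \<le> (norm w)\<^sup>2 * c"
      using mx[OF \<open>norm e = 1\<close>] by (intro mult_left_mono) (auto simp: c_def)
    finally show ?thesis by (simp add: power2_norm_eq_inner mult.commute)
  qed auto
  have "v \<bullet> (A *v v) = c * (v \<bullet> v)" using v by (simp add: c_def flip: power2_norm_eq_inner)
  from symmetric_maximizer_eigenvector[OF sym max this] v max show ?thesis
    by (intro that[of v c]) auto
qed

lemma symmetric_abs_quadratic_form_le:
  fixes A :: "real^'n^'n"
  assumes sym: "\<And>u w. u \<bullet> (A *v w) = w \<bullet> (A *v u)"
  shows "\<bar>w \<bullet> (A *v w)\<bar> \<le> max_abs_eigenvalue A * (norm w)\<^sup>2"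
proof -
  have neg: "(- A) *v u = - (A *v u)" for u
    by (simp add: matrix_vector_mult_def vec_eq_iff sum_negf)
  \<comment> \<open>The matrix \<open>A\<close> bounds the form from above, and \<open>- A\<close> bounds it from below.\<close>
  from symmetric_quadratic_form_maximum[OF sym] obtain c v where
    1: "A *v v = c *\<^sub>R v" "v \<noteq> 0" "w \<bullet> (A *v w) \<le> c * (w \<bullet> w)" by metis
  have "u \<bullet> ((- A) *v w) = w \<bullet> ((- A) *v u)" for u w
    using sym[of u w] by (simp add: neg)
  from symmetric_quadratic_form_maximum[of "- A", OF this] obtain d u where
    2: "(- A) *v u = d *\<^sub>R u" "u \<noteq> 0" "w \<bullet> ((- A) *v w) \<le> d * (w \<bullet> w)" by metis
  have "A *v u = (- d) *\<^sub>R u" using 2(1) by (simp add: neg) (metis minus_minus)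
  from real_eigenvalue_le_max_abs_eigenvalue[OF this 2(2)]
  have d: "d \<le> max_abs_eigenvalue A" by simp
  from real_eigenvalue_le_max_abs_eigenvalue[OF 1(1,2)]
  have c: "c \<le> max_abs_eigenvalue A" by simp
  have "c * (w \<bullet> w) \<le> max_abs_eigenvalue A * (w \<bullet> w)"
    "d * (w \<bullet> w) \<le> max_abs_eigenvalue A * (w \<bullet> w)"
    using c d by (auto intro: mult_right_mono)
  then show ?thesis
    using 1(3) 2(3) by (simp add: neg power2_norm_eq_inner)
qed

lemma hessian_quadratic_form_le:
  fixes f :: "real^'p \<Rightarrow> real"
  assumes "twice_differentiable f"
  shows "\<bar>v \<bullet> (hessian f x *v v)\<bar> \<le> max_abs_eigenvalue (hessian f x) * (norm v)\<^sup>2"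
proof (rule symmetric_abs_quadratic_form_le)
  show "u \<bullet> (hessian f x *v w) = w \<bullet> (hessian f x *v u)" for u w
    using assms unfolding twice_differentiable_def
    by (intro second_derivative_symmetric[of f "gradient f" _ x] gradient_GDERIV
        hessian_has_derivative) auto
qed

section \<open>Taylor bounds\<close>

lemma first_order_taylor_bounds:
  fixes f :: "real^'p \<Rightarrow> real"
  assumes f: "twice_differentiable f" and S: "convex S" "x \<in> S" "x + v \<in> S"
    and M: "\<And>y. y \<in> S \<Longrightarrow> norm (gradient f y) \<le> M"
    and B: "\<And>y. y \<in> S \<Longrightarrow> max_abs_eigenvalue (hessian f y) \<le> B"
  shows "\<bar>f (x + v) - f x\<bar> \<le> M * norm v"
    and "\<bar>f (x + v) - f x - v \<bullet> gradient f x\<bar> \<le> B * (norm v)\<^sup>2"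
proof -
  have seg: "x + s *\<^sub>R v \<in> S" if "0 \<le> s" "s \<le> 1" for s
  proof -
    have "(1 - s) *\<^sub>R x + s *\<^sub>R (x + v) \<in> S"
      using S that by (intro convexD) auto
    then show ?thesis by (simp add: algebra_simps)
  qed
  have d1: "DERIV (\<lambda>s. f (x + s *\<^sub>R v)) s :> v \<bullet> gradient f (x + s *\<^sub>R v)" for s
    using f unfolding twice_differentiable_def
    by (intro GDERIV_along_line gradient_GDERIV) auto
  from MVT2[of 0 1, OF _ d1] obtain s where s: "0 < s" "s < 1"
    and f_eq: "f (x + v) - f x = v \<bullet> gradient f (x + s *\<^sub>R v)" by auto
  have "\<bar>f (x + v) - f x\<bar> \<le> norm v * norm (gradient f (x + s *\<^sub>R v))"
    unfolding f_eq by (rule Cauchy_Schwarz_ineq2)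
  also have "\<dots> \<le> norm v * M" using s by (intro mult_left_mono M seg) auto
  finally show "\<bar>f (x + v) - f x\<bar> \<le> M * norm v" by (simp add: mult.commute)
  have d2: "DERIV (\<lambda>r. v \<bullet> gradient f (x + r *\<^sub>R v)) r :> v \<bullet> (hessian f (x + r *\<^sub>R v) *v v)" for r
  proof -
    have l: "((\<lambda>r. x + r *\<^sub>R v) has_derivative (\<lambda>t. t *\<^sub>R v)) (at r)"
      by (auto intro!: derivative_eq_intros)
    have "(gradient f has_derivative (*v) (hessian f (x + r *\<^sub>R v))) (at (x + r *\<^sub>R v))"
      using f unfolding twice_differentiable_def by (intro hessian_has_derivative) auto
    from has_derivative_inner_right[OF has_derivative_compose[OF l this], of v]
    show ?thesis
      by (simp add: has_field_derivative_def matrix_vector_mult_scaleR mult_commute_abs)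
  qed
  \<comment> \<open>A second application, to the directional derivative between \<open>0\<close> and \<open>s\<close>.  It gives the constant
    \<open>1\<close> in place of \<open>1 / 2\<close>, and continuity of the Hessian is not needed.\<close>
  from MVT2[of 0 s, OF s(1) d2] obtain r where r: "0 < r" "r < s"
    and g_eq: "v \<bullet> gradient f (x + s *\<^sub>R v) - v \<bullet> gradient f x = s * (v \<bullet> (hessian f (x + r *\<^sub>R v) *v v))"
    by auto
  have "\<bar>f (x + v) - f x - v \<bullet> gradient f x\<bar> = s * \<bar>v \<bullet> (hessian f (x + r *\<^sub>R v) *v v)\<bar>"
    using s g_eq by (simp add: f_eq abs_mult)
  also have "\<dots> \<le> \<bar>v \<bullet> (hessian f (x + r *\<^sub>R v) *v v)\<bar>"
    using s by (intro mult_left_le_one_le) auto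
  also have "\<dots> \<le> max_abs_eigenvalue (hessian f (x + r *\<^sub>R v)) * (norm v)\<^sup>2"
    by (rule hessian_quadratic_form_le[OF f])
  also have "\<dots> \<le> B * (norm v)\<^sup>2"
    using r s by (intro mult_right_mono B seg) auto
  finally show "\<bar>f (x + v) - f x - v \<bullet> gradient f x\<bar> \<le> B * (norm v)\<^sup>2" .
qed

lemma abs_exp_minus_one_minus_le:
  fixes x :: real
  shows "\<bar>exp x - 1 - x\<bar> \<le> x\<^sup>2 * exp \<bar>x\<bar>"
proof -
  obtain t where t: "\<bar>t\<bar> \<le> \<bar>x\<bar>" and e: "exp x = (\<Sum>m<2. (x ^ m) / fact m) + (exp t / fact 2) * x ^ 2"
    using Maclaurin_exp_le[of x 2] by blast
  have "\<bar>exp x - 1 - x\<bar> = x\<^sup>2 * (exp t / 2)"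
    unfolding e by (simp add: numeral_2_eq_2 abs_mult)
  also have "exp t / 2 \<le> exp \<bar>x\<bar>"
    using t exp_le_cancel_iff[of t "\<bar>x\<bar>"] exp_gt_zero[of t] by linarith
  then have "x\<^sup>2 * (exp t / 2) \<le> x\<^sup>2 * exp \<bar>x\<bar>" by (intro mult_left_mono) auto
  finally show ?thesis .
qed

section \<open>Reweighting by an almost constant likelihood ratio\<close>

text \<open>
  The probabilistic core: for weights \<open>L\<close> close to \<open>1 + Z\<close> with \<open>Z\<close> centred, the normalised reweighted
  expectation of \<open>H\<close> is \<open>E[H] + E[Z H]\<close> up to an error linear in \<open>\<delta>\<close>.
\<close>

lemma (in prob_space) reweighted_expectation_approx:
  fixes H :: "'a \<Rightarrow> 'b::{banach, second_countable_topology}" and L Z :: "'a \<Rightarrow> real"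
  assumes [measurable]: "H \<in> borel_measurable M" "L \<in> borel_measurable M"
    and Z: "integrable M Z" "expectation Z = 0"
    and H: "AE u in M. norm (H u) \<le> \<eta>"
    and L: "AE u in M. b \<le> L u \<and> L u \<le> B"
    and LZ: "AE u in M. \<bar>L u - 1 - Z u\<bar> \<le> \<delta>"
    and b: "0 < b"
  shows "norm (inverse (\<integral>u. L u \<partial>M) *\<^sub>R (\<integral>u. L u *\<^sub>R H u \<partial>M) - (\<integral>u. H u \<partial>M) - (\<integral>u. Z u *\<^sub>R H u \<partial>M))
    \<le> \<eta> * \<delta> * (1 + B / b)"
proof -
  \<comment> \<open>No integrability is needed here, since the integral of a non-integrable function is \<open>0\<close>.\<close>
  have norm_le: "norm (\<integral>u. F u \<partial>M) \<le> K" if "AE u in M. norm (F u) \<le> K"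
    for F :: "'a \<Rightarrow> 'c::{banach, second_countable_topology}" and K
  proof (cases "integrable M F")
    case True
    have "norm (\<integral>u. F u \<partial>M) \<le> (\<integral>u. norm (F u) \<partial>M)" by simp
    also have "\<dots> \<le> (\<integral>u. K \<partial>M)"
      using that True by (intro integral_mono_AE) auto
    finally show ?thesis by (simp add: prob_space)
  next
    case False
    have "AE u in M. 0 \<le> K" using that by eventually_elim (meson norm_ge_zero order_trans)
    then show ?thesis using False by (simp add: not_integrable_integral_eq)
  qed
  have [measurable]: "Z \<in> borel_measurable M" using Z by auto
  define D where "D = (\<integral>u. L u \<partial>M)"
  have L_norm: "AE u in M. norm (L u) \<le> B"
    using L by eventually_elim (use b in auto)
  have iL: "integrable M L"
    by (rule integrable_const_bound[OF L_norm]) auto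
  have \<eta>: "0 \<le> \<eta>"
    using norm_le[OF H] norm_ge_zero order_trans by blast
  have \<delta>: "0 \<le> \<delta>"
    using norm_le[of "\<lambda>u. L u - 1 - Z u" \<delta>] LZ norm_ge_zero by (metis (mono_tags, lifting) order_trans real_norm_def eventually_mono)
  have B: "0 \<le> B"
    using norm_le[OF L_norm] norm_ge_zero order_trans by blast
  have iH: "integrable M H"
    by (rule integrable_const_bound[OF H]) auto
  have LH_norm: "AE u in M. norm (L u *\<^sub>R H u) \<le> B * \<eta>"
    using H L_norm by eventually_elim (use B in \<open>auto intro!: mult_mono\<close>)
  have iLH: "integrable M (\<lambda>u. L u *\<^sub>R H u)"
    by (rule integrable_const_bound[OF LH_norm]) auto
  have iZH: "integrable M (\<lambda>u. Z u *\<^sub>R H u)"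
  proof (rule Bochner_Integration.integrable_bound)
    show "integrable M (\<lambda>u. \<eta> *\<^sub>R Z u)" using Z by simp
    show "AE u in M. norm (Z u *\<^sub>R H u) \<le> norm (\<eta> *\<^sub>R Z u)"
      using H by eventually_elim (use \<eta> in \<open>auto simp: abs_mult mult.commute[of \<eta>] intro!: mult_left_mono\<close>)
  qed auto
  have "(\<integral>u. b \<partial>M) \<le> D"
    unfolding D_def using L iL by (intro integral_mono_AE) auto
  then have D_ge: "b \<le> D" by (simp add: prob_space)
  have "1 - D = - (\<integral>u. L u - 1 - Z u \<partial>M)"
    using iL Z by (simp add: D_def prob_space)
  then have D_1: "\<bar>1 - D\<bar> \<le> \<delta>"
    using norm_le[of "\<lambda>u. L u - 1 - Z u" \<delta>] LZ by simp
  \<comment> \<open>The error of linearising \<open>L\<close>, plus the error of dropping the normalisation.\<close>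
  have "inverse D *\<^sub>R (\<integral>u. L u *\<^sub>R H u \<partial>M) - (\<integral>u. H u \<partial>M) - (\<integral>u. Z u *\<^sub>R H u \<partial>M)
    = (\<integral>u. (L u - 1 - Z u) *\<^sub>R H u \<partial>M) + ((1 - D) / D) *\<^sub>R (\<integral>u. L u *\<^sub>R H u \<partial>M)"
  proof -
    have "inverse D = 1 + (1 - D) / D" using D_ge b by (simp add: field_simps)
    moreover have "(\<integral>u. (L u - 1 - Z u) *\<^sub>R H u \<partial>M)
        = (\<integral>u. L u *\<^sub>R H u \<partial>M) - (\<integral>u. H u \<partial>M) - (\<integral>u. Z u *\<^sub>R H u \<partial>M)"
      using iH iLH iZH by (simp add: scaleR_diff_left)
    ultimately show ?thesis by (simp add: scaleR_add_left)
  qed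
  also have "norm \<dots> \<le> \<delta> * \<eta> + \<delta> / b * (B * \<eta>)"
  proof (rule norm_triangle_mono)
    show "norm (\<integral>u. (L u - 1 - Z u) *\<^sub>R H u \<partial>M) \<le> \<delta> * \<eta>"
    proof (rule norm_le)
      show "AE u in M. norm ((L u - 1 - Z u) *\<^sub>R H u) \<le> \<delta> * \<eta>"
        using H LZ by eventually_elim (use \<delta> in \<open>auto intro!: mult_mono\<close>)
    qed
    have "\<bar>(1 - D) / D\<bar> \<le> \<delta> / b"
      using D_1 D_ge b \<delta> by (auto simp: abs_div intro!: frac_le)
    then show "norm (((1 - D) / D) *\<^sub>R (\<integral>u. L u *\<^sub>R H u \<partial>M)) \<le> \<delta> / b * (B * \<eta>)"
      unfolding norm_scaleR using norm_le[OF LH_norm] \<delta> b by (intro mult_mono) auto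
  qed
  also have "\<dots> = \<eta> * \<delta> * (1 + B / b)" by (simp add: algebra_simps)
  finally show ?thesis by (simp add: D_def)
qed

section \<open>The conditional expectation as a ratio of integrals\<close>

lemma integral_lborel_affine:
  fixes F :: "'a::euclidean_space \<Rightarrow> 'b::{banach, second_countable_topology}"
  assumes [measurable]: "F \<in> borel_measurable borel" and "0 < c"
  shows "(\<integral>x. F x \<partial>lborel) = c ^ DIM('a) *\<^sub>R (\<integral>x. F (t + c *\<^sub>R x) \<partial>lborel)"
proof -
  have "(\<integral>x. F x \<partial>lborel) = (\<integral>x. F x \<partial>density (distr lborel borel (\<lambda>x. t + c *\<^sub>R x)) (\<lambda>_. \<bar>c\<bar> ^ DIM('a)))"
    using lborel_affine[of c t] \<open>0 < c\<close> by simp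
  also have "\<dots> = c ^ DIM('a) *\<^sub>R (\<integral>x. F (t + c *\<^sub>R x) \<partial>lborel)"
    using \<open>0 < c\<close> by (subst integral_density) (auto simp: integral_distr simp del: scaleR_power)
  finally show ?thesis .
qed

text \<open>
  Integrating out the first variable of a density \<open>p x \<phi> * k \<phi>\<close>.  Only the product is assumed to be
  jointly measurable, and \<open>Z\<close> is bounded only where \<open>k\<close> does not vanish.
\<close>

lemma (in pair_sigma_finite) integral_weighted_marginal:
  fixes p :: "'a \<Rightarrow> 'b \<Rightarrow> real" and k :: "'b \<Rightarrow> real"
    and Z :: "'b \<Rightarrow> 'c::{banach, second_countable_topology}"
  assumes meas: "(\<lambda>(x, \<phi>). p x \<phi> * k \<phi>) \<in> borel_measurable (M1 \<Otimes>\<^sub>M M2)"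
    and [measurable]: "Z \<in> borel_measurable M2"
    and nn: "\<And>x \<phi>. x \<in> space M1 \<Longrightarrow> \<phi> \<in> space M2 \<Longrightarrow> 0 \<le> p x \<phi> * k \<phi>"
    and p: "\<And>\<phi>. integrable M1 (\<lambda>x. p x \<phi>)"
    and m: "integrable M2 (\<lambda>\<phi>. (\<integral>x. p x \<phi> \<partial>M1) * k \<phi>)"
    and Z: "\<And>\<phi>. k \<phi> \<noteq> 0 \<Longrightarrow> norm (Z \<phi>) \<le> \<eta>"
  shows "(\<integral>(x, \<phi>). (p x \<phi> * k \<phi>) *\<^sub>R Z \<phi> \<partial>(M1 \<Otimes>\<^sub>M M2)) = (\<integral>\<phi>. ((\<integral>x. p x \<phi> \<partial>M1) * k \<phi>) *\<^sub>R Z \<phi> \<partial>M2)"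
proof -
  note [measurable] = meas
  \<comment> \<open>Tonelli's theorem reduces integrability of the joint density to that of the marginal one.\<close>
  have ipk: "integrable (M1 \<Otimes>\<^sub>M M2) (\<lambda>(x, \<phi>). p x \<phi> * k \<phi>)"
  proof (rule integrableI_bounded)
    have "(\<integral>\<^sup>+z. ennreal (norm (case z of (x, \<phi>) \<Rightarrow> p x \<phi> * k \<phi>)) \<partial>(M1 \<Otimes>\<^sub>M M2))
        = (\<integral>\<^sup>+\<phi>. (\<integral>\<^sup>+x. ennreal (norm (p x \<phi> * k \<phi>)) \<partial>M1) \<partial>M2)"
      by (subst nn_integral_snd[symmetric]) auto
    also have "\<dots> = (\<integral>\<^sup>+\<phi>. ennreal ((\<integral>x. p x \<phi> \<partial>M1) * k \<phi>) \<partial>M2)"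
    proof (rule nn_integral_cong)
      fix \<phi> assume "\<phi> \<in> space M2"
      then have "(\<integral>\<^sup>+x. ennreal (norm (p x \<phi> * k \<phi>)) \<partial>M1) = (\<integral>\<^sup>+x. ennreal (p x \<phi> * k \<phi>) \<partial>M1)"
        by (intro nn_integral_cong) (use nn in auto)
      also have "\<dots> = ennreal (\<integral>x. p x \<phi> * k \<phi> \<partial>M1)"
        using nn \<open>\<phi> \<in> space M2\<close> p by (intro nn_integral_eq_integral) (auto intro!: AE_I2)
      finally show "(\<integral>\<^sup>+x. ennreal (norm (p x \<phi> * k \<phi>)) \<partial>M1) = ennreal ((\<integral>x. p x \<phi> \<partial>M1) * k \<phi>)"
        by simp
    qed
    also have "\<dots> < \<infinity>"
      using integrableD(2)[OF m] by (metis infinity_ennreal_def less_top real_integrable_def m)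
    finally show "(\<integral>\<^sup>+z. ennreal (norm (case z of (x, \<phi>) \<Rightarrow> p x \<phi> * k \<phi>)) \<partial>(M1 \<Otimes>\<^sub>M M2)) < \<infinity>" .
  qed auto
  have "integrable (M1 \<Otimes>\<^sub>M M2) (\<lambda>(x, \<phi>). (p x \<phi> * k \<phi>) *\<^sub>R Z \<phi>)"
  proof (rule Bochner_Integration.integrable_bound)
    show "integrable (M1 \<Otimes>\<^sub>M M2) (\<lambda>z. (case z of (x, \<phi>) \<Rightarrow> p x \<phi> * k \<phi>) * \<eta>)"
      using ipk by (rule integrable_mult_left)
    have "norm ((p x \<phi> * k \<phi>) *\<^sub>R Z \<phi>) \<le> norm (p x \<phi> * k \<phi> * \<eta>)" for x \<phi>
    proof (cases "k \<phi> = 0")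
      case False
      then have "norm (Z \<phi>) \<le> \<bar>\<eta>\<bar>" using Z[of \<phi>] by simp
      then show ?thesis by (simp add: abs_mult mult_left_mono)
    qed auto
    then show "AE z in M1 \<Otimes>\<^sub>M M2. norm (case z of (x, \<phi>) \<Rightarrow> (p x \<phi> * k \<phi>) *\<^sub>R Z \<phi>)
        \<le> norm ((case z of (x, \<phi>) \<Rightarrow> p x \<phi> * k \<phi>) * \<eta>)"
      by (intro AE_I2) (auto split: prod.split)
    have "(\<lambda>z. (case z of (x, \<phi>) \<Rightarrow> p x \<phi> * k \<phi>) *\<^sub>R Z (snd z)) \<in> borel_measurable (M1 \<Otimes>\<^sub>M M2)"
      by measurable
    then show "(\<lambda>(x, \<phi>). (p x \<phi> * k \<phi>) *\<^sub>R Z \<phi>) \<in> borel_measurable (M1 \<Otimes>\<^sub>M M2)"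
      by (simp add: case_prod_beta')
  qed
  from integral_snd[OF this]
  have "(\<integral>(x, \<phi>). (p x \<phi> * k \<phi>) *\<^sub>R Z \<phi> \<partial>(M1 \<Otimes>\<^sub>M M2)) = (\<integral>\<phi>. (\<integral>x. (p x \<phi> * k \<phi>) *\<^sub>R Z \<phi> \<partial>M1) \<partial>M2)"
    by simp
  also have "(\<lambda>\<phi>. \<integral>x. (p x \<phi> * k \<phi>) *\<^sub>R Z \<phi> \<partial>M1) = (\<lambda>\<phi>. ((\<integral>x. p x \<phi> \<partial>M1) * k \<phi>) *\<^sub>R Z \<phi>)"
    using p by (intro ext) simp
  finally show ?thesis .
qed

lemma integrable_lborel_affine:
  fixes F :: "'a::euclidean_space \<Rightarrow> 'b::{banach, second_countable_topology}"
  assumes [measurable]: "F \<in> borel_measurable borel" and "0 < c"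
    and F: "integrable lborel (\<lambda>x. F (t + c *\<^sub>R x))"
  shows "integrable lborel F"
proof -
  have "integrable (density (distr lborel borel (\<lambda>x. t + c *\<^sub>R x)) (\<lambda>_. \<bar>c\<bar> ^ DIM('a))) F"
    using F \<open>0 < c\<close> by (subst integrable_density) (auto simp: integrable_distr_eq)
  then show ?thesis
    using lborel_affine[of c t] \<open>0 < c\<close> by simp
qed

text \<open>
  The factor \<open>\<tau>\<close> to the power \<open>- p\<close> in the perturbed density cancels the Jacobian of
  \<open>\<phi> = \<theta> + \<tau> u\<close>, in the numerator as well as in the density of the observation.
\<close>

lemma cond_expectation_perturbed:
  fixes MX :: "'x measure" and MY :: "'y measure"
    and f :: "'x \<Rightarrow> 'y \<Rightarrow> real^'p \<Rightarrow> real" and \<kappa> :: "real \<Rightarrow> real^'p \<Rightarrow> real"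
    and h :: "real^'p \<Rightarrow> real^'m" and y :: 'y
  defines "m \<equiv> marginal_density MX f y"
  assumes MX: "sigma_finite_measure MX" and y: "y \<in> space MY"
    and f_nn: "\<And>x \<phi>. x \<in> space MX \<Longrightarrow> 0 \<le> f x y \<phi>"
    and f_int: "\<And>\<phi>. integrable MX (\<lambda>x. f x y \<phi>)"
    and m: "continuous_on UNIV m"
    and g_meas: "perturbed_density f \<kappa> \<theta> \<tau> \<in> borel_measurable (MX \<Otimes>\<^sub>M MY \<Otimes>\<^sub>M lborel)"
    and \<kappa>: "prob_density lborel (\<kappa> \<tau>)"
    and K: "compact K" "\<And>u. u \<notin> K \<Longrightarrow> \<kappa> \<tau> u = 0"
    and h_meas: "h \<in> borel_measurable borel"
    and h_le: "\<And>u. u \<in> K \<Longrightarrow> norm (h (\<tau> *\<^sub>R u)) \<le> \<eta>"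
    and \<tau>: "0 < \<tau>"
  shows "cond_expectation MX (perturbed_density f \<kappa> \<theta> \<tau>) (\<lambda>(x, y, \<phi>). h (\<phi> - \<theta>)) y
    = inverse (\<integral>u. \<kappa> \<tau> u * m (\<theta> + \<tau> *\<^sub>R u) \<partial>lborel)
        *\<^sub>R (\<integral>u. \<kappa> \<tau> u *\<^sub>R (m (\<theta> + \<tau> *\<^sub>R u) *\<^sub>R h (\<tau> *\<^sub>R u)) \<partial>lborel)"
proof -
  interpret MX: sigma_finite_measure MX by fact
  interpret P: pair_sigma_finite MX "lborel :: (real^'p) measure" ..
  have [measurable]: "\<kappa> \<tau> \<in> borel_measurable borel" and \<kappa>_nn: "\<And>u. 0 \<le> \<kappa> \<tau> u"
    and \<kappa>_1: "(\<integral>\<^sup>+u. ennreal (\<kappa> \<tau> u) \<partial>lborel) = 1"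
    using \<kappa> by (auto simp: prob_density_def)
  have \<kappa>_int: "integrable lborel (\<kappa> \<tau>)"
    by (rule integrableI_nonneg) (use \<kappa>_nn \<kappa>_1 in auto)
  have [measurable]: "m \<in> borel_measurable borel"
    by (rule borel_measurable_continuous_onI[OF m])
  note [measurable] = h_meas
  define k where "k \<phi> = inverse (\<tau> ^ CARD('p)) * \<kappa> \<tau> ((\<phi> - \<theta>) /\<^sub>R \<tau>)" for \<phi>
  have [measurable]: "k \<in> borel_measurable borel" unfolding k_def by measurable
  have k_nn: "0 \<le> k \<phi>" for \<phi> using \<kappa>_nn \<tau> by (simp add: k_def)
  have k_affine: "k (\<theta> + \<tau> *\<^sub>R u) = inverse (\<tau> ^ CARD('p)) * \<kappa> \<tau> u" for u
    using \<tau> by (simp add: k_def)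
  have g_eq: "perturbed_density f \<kappa> \<theta> \<tau> (x, y, \<phi>) = f x y \<phi> * k \<phi>" for x \<phi>
    by (simp add: perturbed_density_def k_def)
  have "(\<lambda>z. perturbed_density f \<kappa> \<theta> \<tau> (fst z, y, snd z)) \<in> borel_measurable (MX \<Otimes>\<^sub>M lborel)"
    by (rule measurable_compose[OF _ g_meas]) (use y in measurable)
  then have fk_meas: "(\<lambda>(x, \<phi>). f x y \<phi> * k \<phi>) \<in> borel_measurable (MX \<Otimes>\<^sub>M lborel)"
    by (simp add: g_eq case_prod_beta')
  have cpt: "compact ((\<lambda>u. \<theta> + \<tau> *\<^sub>R u) ` K)"
    by (intro compact_continuous_image[OF _ K(1)] continuous_intros)
  have "bounded (m ` (\<lambda>u. \<theta> + \<tau> *\<^sub>R u) ` K)"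
    by (rule compact_imp_bounded[OF compact_continuous_image[OF continuous_on_subset[OF m] cpt]]) simp
  then obtain C where C: "\<And>u. u \<in> K \<Longrightarrow> \<bar>m (\<theta> + \<tau> *\<^sub>R u)\<bar> \<le> C"
    unfolding bounded_iff by auto
  have "integrable lborel (\<lambda>u. m (\<theta> + \<tau> *\<^sub>R u) * \<kappa> \<tau> u)"
  proof (rule Bochner_Integration.integrable_bound)
    show "integrable lborel (\<lambda>u. C * \<kappa> \<tau> u)" using \<kappa>_int by simp
    have "\<bar>m (\<theta> + \<tau> *\<^sub>R u) * \<kappa> \<tau> u\<bar> \<le> \<bar>C * \<kappa> \<tau> u\<bar>" for u
    proof (cases "u \<in> K")
      case True
      then show ?thesis using C[of u] \<kappa>_nn[of u] by (auto simp: abs_mult intro!: mult_right_mono)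
    qed (simp add: K)
    then show "AE u in lborel. norm (m (\<theta> + \<tau> *\<^sub>R u) * \<kappa> \<tau> u) \<le> norm (C * \<kappa> \<tau> u)"
      by simp
  qed simp
  then have "integrable lborel (\<lambda>u. inverse (\<tau> ^ CARD('p)) * (m (\<theta> + \<tau> *\<^sub>R u) * \<kappa> \<tau> u))"
    by (rule integrable_mult_right)
  then have "integrable lborel (\<lambda>u. m (\<theta> + \<tau> *\<^sub>R u) * k (\<theta> + \<tau> *\<^sub>R u))"
    by (simp only: k_affine mult.left_commute)
  then have mk_int: "integrable lborel (\<lambda>\<phi>. m \<phi> * k \<phi>)"
    by (rule integrable_lborel_affine[OF _ \<tau>, rotated]) measurable
  have marginalise: "(\<integral>(x, \<phi>). (f x y \<phi> * k \<phi>) *\<^sub>R Z \<phi> \<partial>(MX \<Otimes>\<^sub>M lborel))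
      = (\<integral>u. \<kappa> \<tau> u *\<^sub>R (m (\<theta> + \<tau> *\<^sub>R u) *\<^sub>R Z (\<theta> + \<tau> *\<^sub>R u)) \<partial>lborel)"
    if [measurable]: "Z \<in> borel_measurable borel" and "\<And>\<phi>. k \<phi> \<noteq> 0 \<Longrightarrow> norm (Z \<phi>) \<le> K"
    for Z :: "real^'p \<Rightarrow> 'd::{banach, second_countable_topology}" and K
  proof -
    have "(\<integral>(x, \<phi>). (f x y \<phi> * k \<phi>) *\<^sub>R Z \<phi> \<partial>(MX \<Otimes>\<^sub>M lborel))
        = (\<integral>\<phi>. (m \<phi> * k \<phi>) *\<^sub>R Z \<phi> \<partial>lborel)"
      unfolding m_def marginal_density_def
    proof (rule P.integral_weighted_marginal[where \<eta> = K, OF fk_meas])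
      show "integrable lborel (\<lambda>\<phi>. (\<integral>x. f x y \<phi> \<partial>MX) * k \<phi>)"
        using mk_int by (simp add: m_def marginal_density_def)
    qed (use that f_int f_nn k_nn in auto)
    also have "\<dots> = \<tau> ^ CARD('p) *\<^sub>R
        (\<integral>u. (m (\<theta> + \<tau> *\<^sub>R u) * k (\<theta> + \<tau> *\<^sub>R u)) *\<^sub>R Z (\<theta> + \<tau> *\<^sub>R u) \<partial>lborel)"
      by (subst integral_lborel_affine[OF _ \<tau>, of _ \<theta>]) simp_all
    also have "\<dots> = (\<integral>u. \<tau> ^ CARD('p) *\<^sub>R
        ((m (\<theta> + \<tau> *\<^sub>R u) * k (\<theta> + \<tau> *\<^sub>R u)) *\<^sub>R Z (\<theta> + \<tau> *\<^sub>R u)) \<partial>lborel)"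
      by (rule integral_scaleR_right[symmetric])
    also have "\<dots> = (\<integral>u. \<kappa> \<tau> u *\<^sub>R (m (\<theta> + \<tau> *\<^sub>R u) *\<^sub>R Z (\<theta> + \<tau> *\<^sub>R u)) \<partial>lborel)"
      using \<tau> by (intro Bochner_Integration.integral_cong) (auto simp: k_affine mult.commute)
    finally show ?thesis .
  qed
  define D where "D = (\<integral>u. \<kappa> \<tau> u * m (\<theta> + \<tau> *\<^sub>R u) \<partial>lborel)"
  have G: "(\<integral>(x', \<phi>'). f x' y \<phi>' * k \<phi>' \<partial>(MX \<Otimes>\<^sub>M lborel)) = D"
    using marginalise[of "\<lambda>_. 1::real" 1] by (simp add: D_def)
  have h_bound: "norm (h (\<phi> - \<theta>)) \<le> \<eta>" if "k \<phi> \<noteq> 0" for \<phi>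
  proof -
    have "(\<phi> - \<theta>) /\<^sub>R \<tau> \<in> K" using that K(2) by (auto simp: k_def)
    from h_le[OF this] show ?thesis using \<tau> by simp
  qed
  have "cond_expectation MX (perturbed_density f \<kappa> \<theta> \<tau>) (\<lambda>(x, y, \<phi>). h (\<phi> - \<theta>)) y
      = (\<integral>(x, \<phi>). (f x y \<phi> * k \<phi> / D) *\<^sub>R h (\<phi> - \<theta>) \<partial>(MX \<Otimes>\<^sub>M lborel))"
    by (simp add: cond_expectation_def g_eq G)
  also have "\<dots> = (\<integral>z. inverse D *\<^sub>R (case z of (x, \<phi>) \<Rightarrow> (f x y \<phi> * k \<phi>) *\<^sub>R h (\<phi> - \<theta>)) \<partial>(MX \<Otimes>\<^sub>M lborel))"
    by (intro Bochner_Integration.integral_cong) (auto simp: divide_inverse ac_simps)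
  also have "\<dots> = inverse D *\<^sub>R (\<integral>(x, \<phi>). (f x y \<phi> * k \<phi>) *\<^sub>R h (\<phi> - \<theta>) \<partial>(MX \<Otimes>\<^sub>M lborel))"
    by (rule integral_scaleR_right)
  also have "(\<integral>(x, \<phi>). (f x y \<phi> * k \<phi>) *\<^sub>R h (\<phi> - \<theta>) \<partial>(MX \<Otimes>\<^sub>M lborel))
      = (\<integral>u. \<kappa> \<tau> u *\<^sub>R (m (\<theta> + \<tau> *\<^sub>R u) *\<^sub>R h (\<tau> *\<^sub>R u)) \<partial>lborel)"
    using marginalise[of "\<lambda>\<phi>. h (\<phi> - \<theta>)" \<eta>] h_bound by simp
  finally show ?thesis by (simp add: D_def)
qed

section \<open>Expansion of the ratio\<close>

lemma norm_outer: "norm (outer a b) = norm a * norm b"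
proof -
  have "outer a b $ i = a $ i *\<^sub>R b" for i
    by (simp add: outer_def vec_eq_iff)
  then show ?thesis
    by (simp add: norm_vec_def[of "outer a b"] norm_vec_def[of a] L2_set_left_distrib)
qed

lemma outer_mult_vec: "outer a b *v g = (b \<bullet> g) *\<^sub>R a"
  by (simp add: outer_def matrix_vector_mult_def inner_vec_def vec_eq_iff sum_distrib_left
      sum_distrib_right ac_simps)

lemma borel_measurable_outer [measurable (raw)]:
  assumes "F \<in> borel_measurable M" and "G \<in> borel_measurable M"
  shows "(\<lambda>x. outer (F x) (G x)) \<in> borel_measurable M"
  using assms
  by (rule borel_measurable_continuous_Pair)
     (simp add: outer_def continuous_on_vec_lambda continuous_intros)

text \<open>
  This is \<open>reweighted_expectation_approx\<close> for the measure with density \<open>k\<close>, with \<open>L\<close> the likelihood ratio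
  \<open>m (\<theta> + \<tau> u) / m \<theta>\<close> and \<open>Z u = \<tau> (u \<bullet> g)\<close>, centred because \<open>k\<close> has mean zero.
\<close>

lemma perturbation_expansion:
  fixes k m :: "real^'p \<Rightarrow> real" and H :: "real^'p \<Rightarrow> real^'m"
  assumes k: "prob_density lborel k" "\<And>u. k u \<noteq> 0 \<Longrightarrow> norm u \<le> R"
    and mean: "integrable lborel (\<lambda>u. k u *\<^sub>R u)" "(\<integral>u. k u *\<^sub>R u \<partial>lborel) = 0"
    and H_meas: "H \<in> borel_measurable borel" and m_meas: "m \<in> borel_measurable borel"
    and m0: "0 < m \<theta>"
    and H: "\<And>u. norm u \<le> R \<Longrightarrow> k u \<noteq> 0 \<Longrightarrow> norm (H u) \<le> \<eta>"
    and L: "\<And>u. norm u \<le> R \<Longrightarrow> b \<le> m (\<theta> + \<tau> *\<^sub>R u) / m \<theta> \<and> m (\<theta> + \<tau> *\<^sub>R u) / m \<theta> \<le> B"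
    and LZ: "\<And>u. norm u \<le> R \<Longrightarrow> \<bar>m (\<theta> + \<tau> *\<^sub>R u) / m \<theta> - 1 - \<tau> * (u \<bullet> g)\<bar> \<le> \<delta>"
    and b: "0 < b"
  shows "norm (inverse (\<integral>u. k u * m (\<theta> + \<tau> *\<^sub>R u) \<partial>lborel)
                *\<^sub>R (\<integral>u. k u *\<^sub>R (m (\<theta> + \<tau> *\<^sub>R u) *\<^sub>R H u) \<partial>lborel)
              - (\<integral>u. k u *\<^sub>R H u \<partial>lborel)
              - \<tau> *\<^sub>R ((\<integral>u. k u *\<^sub>R outer (H u) u \<partial>lborel) *v g))
    \<le> \<eta> * \<delta> * (1 + B / b)"
proof -
  have [measurable]: "k \<in> borel_measurable borel" and k_nn: "\<And>u. 0 \<le> k u"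
    and k_1: "(\<integral>\<^sup>+u. ennreal (k u) \<partial>lborel) = 1"
    using k(1) by (auto simp: prob_density_def)
  note [measurable] = H_meas m_meas
  define P where "P = density lborel k"
  have sets_P [measurable_cong, simp]: "sets P = sets borel" by (simp add: P_def)
  interpret P: prob_space P
    by (rule prob_spaceI) (simp add: P_def emeasure_density k_1)
  have integral_P: "(\<integral>u. F u \<partial>P) = (\<integral>u. k u *\<^sub>R F u \<partial>lborel)"
    if "F \<in> borel_measurable borel" for F :: "real^'p \<Rightarrow> 'c::{banach, second_countable_topology}"
    unfolding P_def using that k_nn by (subst integral_density) auto
  have AE_P: "AE u in P. Q u" if "\<And>u. norm u \<le> R \<Longrightarrow> k u \<noteq> 0 \<Longrightarrow> Q u" for Q
    unfolding P_def by (subst AE_density) (use that k(2) in \<open>auto intro!: AE_I2\<close>)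
  define L where "L u = m (\<theta> + \<tau> *\<^sub>R u) / m \<theta>" for u
  define Z where "Z u = \<tau> * (u \<bullet> g)" for u
  have [measurable]: "L \<in> borel_measurable borel" "Z \<in> borel_measurable borel"
    unfolding L_def Z_def by measurable
  have kZ: "k u * Z u = \<tau> * ((k u *\<^sub>R u) \<bullet> g)" for u by (simp add: Z_def)
  have Z_int: "integrable P Z"
    unfolding P_def using k_nn mean(1) by (subst integrable_density) (auto simp: kZ simp del: inner_scaleR_left)
  have Z_0: "(\<integral>u. Z u \<partial>P) = 0"
    using mean by (simp add: integral_P kZ integral_inner_left del: inner_scaleR_left)
  have main: "norm (inverse (\<integral>u. L u \<partial>P) *\<^sub>R (\<integral>u. L u *\<^sub>R H u \<partial>P) - (\<integral>u. H u \<partial>P)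
      - (\<integral>u. Z u *\<^sub>R H u \<partial>P)) \<le> \<eta> * \<delta> * (1 + B / b)"
  proof (rule P.reweighted_expectation_approx[OF _ _ Z_int Z_0 _ _ _ b])
    show "AE u in P. norm (H u) \<le> \<eta>" by (rule AE_P) (rule H)
    show "AE u in P. b \<le> L u \<and> L u \<le> B" unfolding L_def by (rule AE_P) (rule L)
    show "AE u in P. \<bar>L u - 1 - Z u\<bar> \<le> \<delta>" unfolding L_def Z_def by (rule AE_P) (rule LZ)
  qed measurable
  have L_eq: "(\<integral>u. L u \<partial>P) = (\<integral>u. k u * m (\<theta> + \<tau> *\<^sub>R u) \<partial>lborel) / m \<theta>"
    by (simp add: integral_P L_def)
  have "(\<integral>u. L u *\<^sub>R H u \<partial>P) = (\<integral>u. inverse (m \<theta>) *\<^sub>R (k u *\<^sub>R (m (\<theta> + \<tau> *\<^sub>R u) *\<^sub>R H u)) \<partial>lborel)"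
    by (subst integral_P) (auto simp: L_def divide_inverse ac_simps)
  also have "\<dots> = inverse (m \<theta>) *\<^sub>R (\<integral>u. k u *\<^sub>R (m (\<theta> + \<tau> *\<^sub>R u) *\<^sub>R H u) \<partial>lborel)"
    by (rule integral_scaleR_right)
  finally have ratio: "inverse (\<integral>u. L u \<partial>P) *\<^sub>R (\<integral>u. L u *\<^sub>R H u \<partial>P)
      = inverse (\<integral>u. k u * m (\<theta> + \<tau> *\<^sub>R u) \<partial>lborel)
          *\<^sub>R (\<integral>u. k u *\<^sub>R (m (\<theta> + \<tau> *\<^sub>R u) *\<^sub>R H u) \<partial>lborel)"
    using m0 by (simp add: L_eq field_simps)
  have "integrable P (\<lambda>u. outer (H u) u)"
  proof (rule P.integrable_const_bound)
    show "AE u in P. norm (outer (H u) u) \<le> \<eta> * R"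
      unfolding norm_outer
      by (rule AE_P) (meson H mult_mono norm_ge_zero order_trans)
  qed measurable
  then have "(\<integral>u. outer (H u) u *v g \<partial>P) = (\<integral>u. outer (H u) u \<partial>P) *v g"
    by (rule integral_bounded_linear[rotated]) 
       (intro linear_conv_bounded_linear[THEN iffD1] linearI, simp_all add: matrix_vector_mult_add_rdistrib scaleR_matrix_vector_assoc)
  moreover have "(\<integral>u. Z u *\<^sub>R H u \<partial>P) = \<tau> *\<^sub>R (\<integral>u. outer (H u) u *v g \<partial>P)"
    by (simp add: Z_def outer_mult_vec flip: scaleR_scaleR)
  ultimately have ZH: "(\<integral>u. Z u *\<^sub>R H u \<partial>P) = \<tau> *\<^sub>R ((\<integral>u. k u *\<^sub>R outer (H u) u \<partial>lborel) *v g)"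
    by (simp add: integral_P)
  from main show ?thesis
    unfolding ratio ZH by (simp only: integral_P H_meas)
qed

lemma rpow_mult_le:
  assumes "0 < \<tau>" "0 \<le> x" "x \<le> R" "0 \<le> \<alpha>" "0 < R"
  shows "rpow (\<tau> * x) \<alpha> \<le> rpow R \<alpha> * \<tau> powr \<alpha>"
proof (cases "\<alpha> = 0")
  case False
  then have "(\<tau> * x) powr \<alpha> \<le> (\<tau> * R) powr \<alpha>"
    using assms by (intro powr_mono2) auto
  then show ?thesis using False assms by (simp add: rpow_def powr_mult mult.commute)
qed (use assms in \<open>simp add: rpow_def\<close>)

section \<open>The bias expansion\<close>

theorem theorem1:
  fixes MX :: "'x measure" and MY :: "'y measure"
    and f :: "'x \<Rightarrow> 'y \<Rightarrow> real^'p \<Rightarrow> real"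
    and ystar :: 'y
    and \<kappa> :: "real \<Rightarrow> real^'p \<Rightarrow> real"
    and h :: "real^'p \<Rightarrow> real^'m"
    and K0 :: "(real^'p) set"
    and \<alpha> c \<epsilon> :: real
  defines "l \<equiv> log_likelihood MX f ystar"
    and "\<tau>0 \<equiv> Sup {\<tau>. 0 < \<tau> \<and> K0 \<subseteq> cball 0 (\<epsilon> / \<tau>)}"
  assumes "sigma_finite_measure MX" and "sigma_finite_measure MY"
    and "\<forall>\<theta>. prob_density (MX \<Otimes>\<^sub>M MY) (\<lambda>(x, y). f x y \<theta>)"
    and "ystar \<in> space MY"
    and "\<forall>\<theta>. integrable MX (\<lambda>x. f x ystar \<theta>) \<and> 0 < marginal_density MX f ystar \<theta>"
    and "\<forall>\<tau>>0. prob_density lborel (\<kappa> \<tau>)"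
    and "\<forall>\<tau>>0. integrable lborel (\<lambda>u. \<kappa> \<tau> u *\<^sub>R u) \<and> (\<integral>u. \<kappa> \<tau> u *\<^sub>R u \<partial>lborel) = 0"
    and "\<forall>\<theta>. \<forall>\<tau>>0. prob_density (MX \<Otimes>\<^sub>M MY \<Otimes>\<^sub>M lborel) (perturbed_density f \<kappa> \<theta> \<tau>)"
    and "compact K0" and "\<forall>\<tau>>0. \<forall>u. u \<notin> K0 \<longrightarrow> \<kappa> \<tau> u = 0"
    and "twice_differentiable l"
    and "\<forall>K1. compact K1 \<longrightarrow> bdd_above ((\<lambda>\<theta>. norm (gradient l \<theta>)) ` K1)"
    and "\<forall>K1. compact K1 \<longrightarrow> bdd_above ((\<lambda>\<theta>. max_abs_eigenvalue (hessian l \<theta>)) ` K1)"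
    and "h \<in> borel_measurable borel"
    and "0 \<le> \<alpha>" and "0 < c" and "0 < \<epsilon>"
    and "\<forall>u \<in> cball 0 \<epsilon>. norm (h u) \<le> c * rpow (norm u) \<alpha>"
  shows "\<forall>K2. compact K2 \<longrightarrow>
    (\<exists>C1 \<tau>1. 0 < \<tau>1 \<and> \<tau>1 \<le> \<tau>0 \<and>
      (\<forall>\<tau>. 0 < \<tau> \<and> \<tau> \<le> \<tau>1 \<longrightarrow>
        (SUP \<theta>\<in>K2. ereal (norm (
            cond_expectation MX (perturbed_density f \<kappa> \<theta> \<tau>) (\<lambda>(x, y, \<phi>). h (\<phi> - \<theta>)) ystar
            - (\<integral>u. \<kappa> \<tau> u *\<^sub>R h (\<tau> *\<^sub>R u) \<partial>lborel)
            - \<tau> *\<^sub>R ((\<integral>u. \<kappa> \<tau> u *\<^sub>R outer (h (\<tau> *\<^sub>R u)) u \<partial>lborel) *v gradient l \<theta>))))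
          \<le> ereal (C1 * \<tau> powr (2 + \<alpha>))))"
proof (intro allI impI)
  note MX = assms(3) and f_density = assms(5) and y = assms(6) and marginal = assms(7)
    and \<kappa> = assms(8) and mean = assms(9) and g = assms(10) and K0 = assms(11,12) and l = assms(13)
    and grad_bdd = assms(14) and hess_bdd = assms(15)
    and h = assms(16) and \<alpha> = assms(17) and c = assms(18) and \<epsilon> = assms(19) and h_le = assms(20)
  fix K2 :: "(real^'p) set" assume "compact K2"
  define m where "m = marginal_density MX f ystar"
  have m_pos: "0 < m \<theta>" for \<theta> using marginal by (simp add: m_def)
  have l_eq: "l \<theta> = ln (m \<theta>)" for \<theta> by (simp add: l_def m_def log_likelihood_def)
  have m_eq: "m = (\<lambda>\<theta>. exp (l \<theta>))" using m_pos by (simp add: l_eq)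
  have "continuous_on UNIV l"
    using l by (auto simp: twice_differentiable_def intro!: differentiable_imp_continuous_on
        simp: differentiable_on_def)
  then have m_cont: "continuous_on UNIV m"
    unfolding m_eq by (rule continuous_on_exp)
  have m_meas: "m \<in> borel_measurable borel"
    by (rule borel_measurable_continuous_onI[OF m_cont])
  have f_nn: "0 \<le> f x ystar \<phi>" if "x \<in> space MX" for x \<phi>
    using f_density y that by (auto simp: prob_density_def space_pair_measure)
  obtain R where R: "0 < R" "\<And>u. u \<in> K0 \<Longrightarrow> norm u \<le> R"
    using compact_imp_bounded[OF \<open>compact K0\<close>] by (auto simp: bounded_pos)
  obtain r where r: "\<And>\<theta>. \<theta> \<in> K2 \<Longrightarrow> norm \<theta> \<le> r"
    using compact_imp_bounded[OF \<open>compact K2\<close>] by (auto simp: bounded_iff)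
  \<comment> \<open>A convex compact set containing \<open>\<theta> + \<tau> u\<close> for all \<open>\<theta> \<in> K2\<close>, \<open>u \<in> K0\<close> and \<open>0 < \<tau> \<le> 1\<close>.\<close>
  define S where "S = cball (0::real^'p) (r + R)"
  have S: "compact S" "convex S" by (auto simp: S_def)
  obtain M0 where M0: "\<And>y. y \<in> S \<Longrightarrow> norm (gradient l y) \<le> M0"
    using grad_bdd S(1) by (meson bdd_above.E imageI)
  obtain B0 where B0: "\<And>y. y \<in> S \<Longrightarrow> max_abs_eigenvalue (hessian l y) \<le> B0"
    using hess_bdd S(1) by (meson bdd_above.E imageI)
  define M where "M = max 0 M0"
  define B where "B = max 0 B0"
  have M: "0 \<le> M" "\<And>y. y \<in> S \<Longrightarrow> norm (gradient l y) \<le> M"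
    using M0 by (auto simp: M_def le_max_iff_disj)
  have B: "0 \<le> B" "\<And>y. y \<in> S \<Longrightarrow> max_abs_eigenvalue (hessian l y) \<le> B"
    using B0 by (auto simp: B_def le_max_iff_disj)
  define A where "A = (M * R)\<^sup>2 * exp (M * R) + B * R\<^sup>2"
  define C1 where "C1 = c * rpow R \<alpha> * A * (1 + exp (M * R) / exp (- (M * R)))"
  \<comment> \<open>Since \<open>K0\<close> lies in the ball of radius \<open>R\<close>, both \<open>\<epsilon> / R\<close> and every smaller positive
    number belong to the set whose supremum is \<open>\<tau>0\<close>.\<close>
  define \<tau>1 where "\<tau>1 = min 1 (\<epsilon> / R)"

  have \<tau>1_pos: "0 < \<tau>1" using \<epsilon> R by (simp add: \<tau>1_def)
  have \<tau>1_small: "\<tau> * norm u \<le> \<epsilon>" if "0 < \<tau>" "\<tau> \<le> \<tau>1" "u \<in> K0" for \<tau> u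
  proof -
    have "\<tau> * norm u \<le> (\<epsilon> / R) * R"
      using that R by (intro mult_mono) (auto simp: \<tau>1_def)
    then show ?thesis using R by simp
  qed
  have \<tau>1_le: "\<tau>1 \<le> \<tau>0"
    unfolding \<tau>0_def
  proof (rule cSup_upper)
    show "\<tau>1 \<in> {\<tau>. 0 < \<tau> \<and> K0 \<subseteq> cball 0 (\<epsilon> / \<tau>)}"
      using \<tau>1_pos \<tau>1_small[OF \<tau>1_pos order_refl] by (auto simp: field_simps)
    \<comment> \<open>A density cannot vanish off a null set, so \<open>K0\<close> has a nonzero point \<open>v\<close>, and
      \<open>\<epsilon> / norm v\<close> bounds the set defining \<open>\<tau>0\<close>.\<close>
    have "\<exists>v\<in>K0. v \<noteq> 0"
    proof (rule ccontr)
      assume "\<not> (\<exists>v\<in>K0. v \<noteq> 0)"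
      then have "\<kappa> 1 u = 0" if "u \<noteq> 0" for u
        using that K0(2) by (meson zero_less_one)
      then have "AE u in lborel. ennreal (\<kappa> 1 u) = 0"
        by (auto intro!: AE_mp[OF AE_lborel_singleton[of "0::real^'p"] AE_I2])
      then have "(\<integral>\<^sup>+u. ennreal (\<kappa> 1 u) \<partial>lborel) = (\<integral>\<^sup>+u. 0 \<partial>(lborel :: (real^'p) measure))"
        by (rule nn_integral_cong_AE)
      moreover have "prob_density lborel (\<kappa> 1)" using \<kappa> by simp
      ultimately show False
        by (simp add: prob_density_def)
    qed
    then obtain v where v: "v \<in> K0" "v \<noteq> 0" by blast
    show "bdd_above {\<tau>. 0 < \<tau> \<and> K0 \<subseteq> cball 0 (\<epsilon> / \<tau>)}"
    proof (rule bdd_aboveI)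
      fix \<tau> assume "\<tau> \<in> {\<tau>. 0 < \<tau> \<and> K0 \<subseteq> cball 0 (\<epsilon> / \<tau>)}"
      then have "0 < \<tau>" "norm v \<le> \<epsilon> / \<tau>" using v by auto
      then show "\<tau> \<le> \<epsilon> / norm v" using v by (simp add: field_simps)
    qed
  qed

  have bound: "norm (cond_expectation MX (perturbed_density f \<kappa> \<theta> \<tau>) (\<lambda>(x, y, \<phi>). h (\<phi> - \<theta>)) ystar
            - (\<integral>u. \<kappa> \<tau> u *\<^sub>R h (\<tau> *\<^sub>R u) \<partial>lborel)
            - \<tau> *\<^sub>R ((\<integral>u. \<kappa> \<tau> u *\<^sub>R outer (h (\<tau> *\<^sub>R u)) u \<partial>lborel) *v gradient l \<theta>))
      \<le> C1 * \<tau> powr (2 + \<alpha>)"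
    if \<tau>: "0 < \<tau>" "\<tau> \<le> \<tau>1" and \<theta>: "\<theta> \<in> K2" for \<tau> \<theta>
  proof -
    have \<tau>_le_1: "\<tau> \<le> 1" using \<tau> by (simp add: \<tau>1_def)
    have \<kappa>_supp: "u \<in> K0" if "\<kappa> \<tau> u \<noteq> 0" for u using that K0(2) \<tau> by blast
    define \<eta> where "\<eta> = c * rpow R \<alpha> * \<tau> powr \<alpha>"
    have h_bound: "norm (h (\<tau> *\<^sub>R u)) \<le> \<eta>" if "u \<in> K0" for u
    proof -
      have "\<tau> *\<^sub>R u \<in> cball 0 \<epsilon>" using \<tau>1_small[OF \<tau> that] \<tau> by simp
      then have "norm (h (\<tau> *\<^sub>R u)) \<le> c * rpow (\<tau> * norm u) \<alpha>"
        using h_le \<tau> by fastforce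
      also have "\<dots> \<le> c * (rpow R \<alpha> * \<tau> powr \<alpha>)"
        using c \<tau> \<alpha> R that by (intro mult_left_mono rpow_mult_le) auto
      finally show ?thesis by (simp add: \<eta>_def mult.assoc)
    qed
    have h_meas: "(\<lambda>u. h (\<tau> *\<^sub>R u)) \<in> borel_measurable borel"
      using h by measurable
    have cond: "cond_expectation MX (perturbed_density f \<kappa> \<theta> \<tau>) (\<lambda>(x, y, \<phi>). h (\<phi> - \<theta>)) ystar
        = inverse (\<integral>u. \<kappa> \<tau> u * m (\<theta> + \<tau> *\<^sub>R u) \<partial>lborel)
            *\<^sub>R (\<integral>u. \<kappa> \<tau> u *\<^sub>R (m (\<theta> + \<tau> *\<^sub>R u) *\<^sub>R h (\<tau> *\<^sub>R u)) \<partial>lborel)"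
      unfolding m_def
      by (rule cond_expectation_perturbed[OF MX y _ _ _ _ _ \<open>compact K0\<close> _ h h_bound \<tau>(1)])
         (use f_nn marginal m_cont g \<kappa> K0(2) \<tau>(1) in \<open>auto simp: prob_density_def m_def\<close>)
    have taylor: "\<bar>l (\<theta> + \<tau> *\<^sub>R u) - l \<theta>\<bar> \<le> \<tau> * (M * R)"
      "\<bar>l (\<theta> + \<tau> *\<^sub>R u) - l \<theta> - \<tau> * (u \<bullet> gradient l \<theta>)\<bar> \<le> B * R\<^sup>2 * \<tau>\<^sup>2"
      if u: "norm u \<le> R" for u
    proof -
      have tu: "norm (\<tau> *\<^sub>R u) \<le> \<tau> * R" using u \<tau> by simp
      have "\<tau> * R \<le> R" using \<tau> \<tau>_le_1 R by simp
      then have "norm (\<theta> + \<tau> *\<^sub>R u) \<le> r + R"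
        using r[OF \<theta>] tu norm_triangle_ineq[of \<theta> "\<tau> *\<^sub>R u"] by linarith
      then have in_S: "\<theta> \<in> S" "\<theta> + \<tau> *\<^sub>R u \<in> S"
        using r[OF \<theta>] R(1) by (auto simp: S_def)
      note T = first_order_taylor_bounds[OF l S(2) in_S M(2) B(2)]
      have "\<bar>l (\<theta> + \<tau> *\<^sub>R u) - l \<theta>\<bar> \<le> M * norm (\<tau> *\<^sub>R u)" by (rule T(1))
      also have "\<dots> \<le> M * (\<tau> * R)" using tu M(1) by (rule mult_left_mono)
      finally show "\<bar>l (\<theta> + \<tau> *\<^sub>R u) - l \<theta>\<bar> \<le> \<tau> * (M * R)" by (simp add: ac_simps)
      have "\<bar>l (\<theta> + \<tau> *\<^sub>R u) - l \<theta> - (\<tau> *\<^sub>R u) \<bullet> gradient l \<theta>\<bar> \<le> B * (norm (\<tau> *\<^sub>R u))\<^sup>2" by (rule T(2))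
      also have "\<dots> \<le> B * (\<tau> * R)\<^sup>2" using tu B(1) by (intro mult_left_mono power_mono) auto
      finally show "\<bar>l (\<theta> + \<tau> *\<^sub>R u) - l \<theta> - \<tau> * (u \<bullet> gradient l \<theta>)\<bar> \<le> B * R\<^sup>2 * \<tau>\<^sup>2"
        by (simp add: power_mult_distrib ac_simps)
    qed
    have ratio: "m (\<theta> + \<tau> *\<^sub>R u) / m \<theta> = exp (l (\<theta> + \<tau> *\<^sub>R u) - l \<theta>)" for u
      by (simp add: m_eq exp_diff)
    have abs_le: "\<bar>l (\<theta> + \<tau> *\<^sub>R u) - l \<theta>\<bar> \<le> M * R" if "norm u \<le> R" for u
    proof -
      have "\<tau> * (M * R) \<le> M * R" using \<tau> \<tau>_le_1 M R by (intro mult_left_le_one_le) auto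
      then show ?thesis using taylor(1)[OF that] by simp
    qed
    have LZ: "\<bar>m (\<theta> + \<tau> *\<^sub>R u) / m \<theta> - 1 - \<tau> * (u \<bullet> gradient l \<theta>)\<bar> \<le> A * \<tau>\<^sup>2" if u: "norm u \<le> R" for u
    proof -
      define a where "a = l (\<theta> + \<tau> *\<^sub>R u) - l \<theta>"
      have "\<bar>exp a - 1 - a\<bar> \<le> a\<^sup>2 * exp \<bar>a\<bar>" by (rule abs_exp_minus_one_minus_le)
      also have "\<dots> \<le> (\<tau> * (M * R))\<^sup>2 * exp (M * R)"
        using taylor(1)[OF u] abs_le[OF u] unfolding a_def
        by (intro mult_mono) (auto intro: abs_le_square_iff[THEN iffD1])
      finally have "\<bar>exp a - 1 - a\<bar> \<le> (M * R)\<^sup>2 * exp (M * R) * \<tau>\<^sup>2"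
        by (simp add: power_mult_distrib ac_simps)
      moreover have "\<bar>a - \<tau> * (u \<bullet> gradient l \<theta>)\<bar> \<le> B * R\<^sup>2 * \<tau>\<^sup>2"
        using taylor(2)[OF u] by (simp add: a_def)
      ultimately show ?thesis
        unfolding ratio a_def[symmetric] A_def distrib_right by linarith
    qed
    have "norm (cond_expectation MX (perturbed_density f \<kappa> \<theta> \<tau>) (\<lambda>(x, y, \<phi>). h (\<phi> - \<theta>)) ystar
            - (\<integral>u. \<kappa> \<tau> u *\<^sub>R h (\<tau> *\<^sub>R u) \<partial>lborel)
            - \<tau> *\<^sub>R ((\<integral>u. \<kappa> \<tau> u *\<^sub>R outer (h (\<tau> *\<^sub>R u)) u \<partial>lborel) *v gradient l \<theta>))
        \<le> \<eta> * (A * \<tau>\<^sup>2) * (1 + exp (M * R) / exp (- (M * R)))"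
      unfolding cond
    proof (rule perturbation_expansion[where R = R, OF _ _ _ _ h_meas m_meas m_pos _ _ LZ])
      show "exp (- (M * R)) \<le> m (\<theta> + \<tau> *\<^sub>R u) / m \<theta> \<and> m (\<theta> + \<tau> *\<^sub>R u) / m \<theta> \<le> exp (M * R)"
        if "norm u \<le> R" for u
        using abs_le[OF that] unfolding ratio exp_le_cancel_iff abs_le_iff by linarith
    qed (use \<kappa> mean \<tau>(1) R(2) \<kappa>_supp h_bound in auto)
    also have "\<dots> = C1 * \<tau> powr (2 + \<alpha>)"
      using \<tau>(1) by (simp add: \<eta>_def C1_def powr_add)
    finally show ?thesis .
  qed
  show "\<exists>C1 \<tau>1. 0 < \<tau>1 \<and> \<tau>1 \<le> \<tau>0 \<and>
      (\<forall>\<tau>. 0 < \<tau> \<and> \<tau> \<le> \<tau>1 \<longrightarrow>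
        (SUP \<theta>\<in>K2. ereal (norm (
            cond_expectation MX (perturbed_density f \<kappa> \<theta> \<tau>) (\<lambda>(x, y, \<phi>). h (\<phi> - \<theta>)) ystar
            - (\<integral>u. \<kappa> \<tau> u *\<^sub>R h (\<tau> *\<^sub>R u) \<partial>lborel)
            - \<tau> *\<^sub>R ((\<integral>u. \<kappa> \<tau> u *\<^sub>R outer (h (\<tau> *\<^sub>R u)) u \<partial>lborel) *v gradient l \<theta>))))
          \<le> ereal (C1 * \<tau> powr (2 + \<alpha>)))"
    by (intro exI[of _ C1] exI[of _ \<tau>1] conjI allI impI SUP_least \<tau>1_pos \<tau>1_le) (simp add: bound)
qed

end
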